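(* Let $\alpha\in\mathbb{R}\setminus\mathbb{Q}$. Then $\alpha\notin\mathfrak{L}$ if and only if for every $\gamma\in\mathbb{R}$ satisfying $\|n\alpha-\gamma\|>0$ for all $n\in\mathbb{N}$ there is a constant $c>0$ such that $$R_N(\alpha,\gamma):=\sum_{1\le n\le N}\frac{1}{\|n\alpha-\gamma\|}\ \ge\ c\,N\log N\qquad\text{for all integers } N\ge 2.$$
   Context: $\|x\|$ denotes the distance from $x\in\mathbb{R}$ to the nearest integer. $\mathfrak{L}$ denotes the set of Liouville numbers, i.e. of $\alpha\in\mathbb{R}\setminus\mathbb{Q}$ such that $\liminf_{n\to\infty}n^w\|n\alpha\|=0$ for all $w>0$. *)

theory Defs
  imports Complex_Main "HOL-Library.Extended_Real"
begin

text \<open>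
  Distance to the nearest integer. At half-integers \<open>round\<close> picks the larger of the two
  nearest integers, which does not affect the value.
\<close>
definition int_dist :: "real \<Rightarrow> real" where
  "int_dist x = \<bar>x - of_int (round x)\<bar>"

text \<open>The lower limit is taken in \<open>ereal\<close>, since \<^const>\<open>Liminf\<close> needs a complete lattice.\<close>
definition Liouville :: "real set" where
  "Liouville = {\<alpha>. \<alpha> \<notin> \<rat> \<and>
     (\<forall>w::real. w > 0 \<longrightarrow> liminf (\<lambda>n. ereal (real n powr w * int_dist (real n * \<alpha>))) = 0)}"

definition recip_sum :: "nat \<Rightarrow> real \<Rightarrow> real \<Rightarrow> real" where
  "recip_sum N \<alpha> \<gamma> = (\<Sum>n=1..N. 1 / int_dist (real n * \<alpha> - \<gamma>))"

end

theory Submission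
  imports Defs "HOL-Analysis.Analysis"
begin

text \<open>
  Throughout, \<open>\<parallel>x\<parallel>\<close> stands for \<open>int_dist x\<close>.

  Suppose that \<open>p/q\<close> is in lowest terms and close to \<open>\<alpha>\<close>. Over \<open>q\<close> consecutive values of \<open>n\<close>
  the points \<open>n\<alpha> - \<gamma>\<close> modulo 1 are then nearly a translate of the \<open>q\<close> equally spaced points
  \<open>j/q\<close>, so that the sum of \<open>1 / \<parallel>n\<alpha> - \<gamma>\<parallel>\<close> over this block is about \<open>q\<close> times a harmonic sum, i.e.
  of order \<open>q log q\<close>, unless one point falls exceptionally close to 0. Adding up the blocks, the
  sum up to \<open>N\<close> has order \<open>N log q\<close>. The question is therefore how \<open>log q\<close> compares with \<open>log N\<close>.

  If \<open>\<alpha>\<close> is not Liouville, Dirichlet's theorem gives, for each \<open>N\<close>, a denominator \<open>q \<le> N\<close> with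
  \<open>\<parallel>q\<alpha>\<parallel> < 1/N\<close>. An inequality \<open>\<parallel>q\<alpha>\<parallel> \<ge> \<delta> / q^w\<close> forces \<open>q\<close> to be at least a fixed power of \<open>N\<close>, so
  \<open>log q\<close> is comparable to \<open>log N\<close>. An exceptionally small term only helps here
  (\<open>recip_sum_ge_ln_denominator\<close>, \<open>recip_sum_ge_of_not_Liouville\<close>).

  If \<open>\<alpha>\<close> is Liouville, there are \<open>q\<close> for which the approximation by \<open>p/q\<close> remains valid up to
  \<open>N = q^(v+1)\<close>, with \<open>v\<close> as large as desired, and then \<open>log q = log N / (v+1)\<close>. The upper bound
  \<open>recip_sum_le_ln_denominator\<close> needs that no term is exceptionally small, which is guaranteed by
  \<open>\<parallel>q\<gamma>\<parallel> \<ge> 1/4\<close>: then \<open>\<gamma>\<close> is at distance at least \<open>1/(4q)\<close> from all multiples of \<open>1/q\<close>. A Baire category argument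
  (\<open>Liouville_generic_shift\<close>) produces one \<open>\<gamma>\<close> with this property for suitable \<open>q\<close> at every quality of
  approximation. Such a \<open>\<gamma>\<close> is never of the form \<open>n\<alpha> + k\<close>, because \<open>\<parallel>q n \<alpha>\<parallel>\<close> becomes small along
  these \<open>q\<close> for each fixed \<open>n\<close>.
\<close>

section \<open>The distance to the nearest integer\<close>

lemma int_dist_nonneg [simp]: "0 \<le> int_dist x"
  by (simp add: int_dist_def)

lemma int_dist_le: "int_dist x \<le> \<bar>x - of_int m\<bar>"
  unfolding int_dist_def by (rule round_diff_minimal)

lemma int_dist_le_abs: "int_dist x \<le> \<bar>x\<bar>"
  using int_dist_le[of x 0] by simp

lemma int_dist_le_half: "int_dist x \<le> 1 / 2"
  unfolding int_dist_def using of_int_round_abs_le[of x] by (simp add: abs_minus_commute)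

lemma int_dist_lipschitz: "int_dist x \<le> int_dist y + \<bar>x - y\<bar>"
  using int_dist_le[of x "round y"] unfolding int_dist_def by linarith

lemma int_dist_add_int [simp]: "int_dist (x + of_int m) = int_dist x"
proof (rule antisym)
  show "int_dist (x + of_int m) \<le> int_dist x"
    using int_dist_le[of "x + of_int m" "round x + m"] by (simp add: int_dist_def)
  show "int_dist x \<le> int_dist (x + of_int m)"
    using int_dist_le[of x "round (x + of_int m) - m"] by (simp add: int_dist_def algebra_simps)
qed

lemma int_dist_minus [simp]: "int_dist (- x) = int_dist x"
proof -
  have "int_dist (- x) \<le> int_dist x" for x
    using int_dist_le[of "- x" "- round x"] by (simp add: int_dist_def abs_minus_commute)
  from this[of x] this[of "- x"] show ?thesis by simp
qed

lemma int_dist_mult_le: "int_dist (of_int n * x) \<le> \<bar>of_int n\<bar> * int_dist x"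
proof -
  have "int_dist (of_int n * x) \<le> \<bar>of_int n * x - of_int (n * round x)\<bar>"
    by (rule int_dist_le)
  also have "\<dots> = \<bar>of_int n\<bar> * int_dist x"
    by (simp add: int_dist_def abs_mult [symmetric] right_diff_distrib)
  finally show ?thesis .
qed

lemma int_dist_int_plus_half [simp]: "int_dist (of_int m + 1 / 2) = 1 / 2"
proof -
  have "round (1 / 2 :: real) = 1" by (simp add: round_def)
  then have "int_dist (1 / 2) = 1 / 2" by (simp add: int_dist_def)
  then show ?thesis using int_dist_add_int[of "1 / 2" m] by (simp add: add.commute)
qed

lemma continuous_on_int_dist: "continuous_on A int_dist"
proof -
  have "1-lipschitz_on A int_dist"
  proof (rule lipschitz_onI)
    fix x y :: real
    show "dist (int_dist x) (int_dist y) \<le> 1 * dist x y"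
      using int_dist_lipschitz[of x y] int_dist_lipschitz[of y x] by (simp add: dist_real_def)
  qed simp
  then show ?thesis by (rule lipschitz_on_continuous_on)
qed

text \<open>
  Whichever of the two endpoints is nearer to \<open>x\<close>, its reciprocal distance is one of the summands.
  Unlike a minimum, this sum splits into two harmonic sums when \<open>x\<close> runs through \<open>(j + t) / q\<close>.
\<close>
lemma inverse_int_dist_le:
  assumes "0 < x" "x < 1"
  shows "1 / int_dist x \<le> 1 / x + 1 / (1 - x)"
proof -
  have "round x = 0 \<or> round x = 1"
    using assms unfolding round_def by linarith
  then show ?thesis
    using assms by (auto simp: int_dist_def)
qed

lemma int_dist_frac [simp]: "int_dist (frac x) = int_dist x"
  using int_dist_add_int[of "frac x" "\<lfloor>x\<rfloor>"] by (simp add: frac_def)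

lemma int_dist_irrational_pos:
  assumes "\<alpha> \<notin> \<rat>" "0 < n"
  shows "0 < int_dist (real n * \<alpha>)"
proof (rule ccontr)
  assume "\<not> 0 < int_dist (real n * \<alpha>)"
  then have "real n * \<alpha> = of_int (round (real n * \<alpha>))"
    using int_dist_nonneg[of "real n * \<alpha>"] by (simp add: int_dist_def)
  then have "\<alpha> = of_int (round (real n * \<alpha>)) / real n"
    using assms(2) by (simp add: field_simps)
  also have "\<dots> \<in> \<rat>" by simp
  finally show False using assms(1) by simp
qed

section \<open>Sums over a complete residue system\<close>

text \<open>
  Since \<open>p\<close> is invertible modulo \<open>q\<close>, the map \<open>i \<mapsto> i p + b\<close> permutes the residues modulo \<open>q\<close>.
  Taking \<open>b\<close> to be the integer part of \<open>q \<theta>\<close> also absorbs the shift \<open>\<theta>\<close>, up to a remainder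
  of less than one step \<open>1/q\<close>.
\<close>
lemma sum_residues_periodic:
  fixes f :: "real \<Rightarrow> 'a::comm_monoid_add"
  assumes per: "\<And>x m. f (x + of_int m) = f x"
    and cop: "coprime p (int q)" and q: "0 < q"
  shows "(\<Sum>i<q. f (real i * of_int p / real q + \<theta>)) =
         (\<Sum>j<q. f ((real j + frac (real q * \<theta>)) / real q))"
proof -
  define b where "b = \<lfloor>real q * \<theta>\<rfloor>"
  define \<sigma> where "\<sigma> i = nat ((int i * p + b) mod int q)" for i
  have \<sigma>_int: "int (\<sigma> i) = (int i * p + b) mod int q" for i
    using q by (simp add: \<sigma>_def)
  have maps: "\<sigma> ` {..<q} \<subseteq> {..<q}"
    using q by (auto simp: \<sigma>_def nat_less_iff)
  have inj: "inj_on \<sigma> {..<q}"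
  proof (rule inj_onI)
    fix i k assume ik: "i \<in> {..<q}" "k \<in> {..<q}" and eq: "\<sigma> i = \<sigma> k"
    have "(int i * p + b) mod int q = (int k * p + b) mod int q"
      using eq \<sigma>_int by metis
    then have "int q dvd (int i * p + b) - (int k * p + b)"
      by (simp add: mod_eq_dvd_iff)
    then have "int q dvd (int i - int k) * p"
      by (simp add: algebra_simps)
    then have "int q dvd int i - int k"
      using cop by (simp add: coprime_dvd_mult_left_iff coprime_commute)
    then have "int i mod int q = int k mod int q"
      by (simp add: mod_eq_dvd_iff)
    then show "i = k" using ik by simp
  qed
  have bij: "bij_betw \<sigma> {..<q} {..<q}"
    using inj maps by (simp add: bij_betw_def endo_inj_surj)
  have shift: "f (real i * of_int p / real q + \<theta>) =
      f ((real (\<sigma> i) + frac (real q * \<theta>)) / real q)" for i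
  proof -
    define d where "d = (int i * p + b) div int q"
    have "int i * p + b = int q * d + int (\<sigma> i)"
      by (simp add: \<sigma>_int d_def)
    then have "of_int (int i * p + b) = (of_int (int q * d + int (\<sigma> i)) :: real)"
      by simp
    then have "real i * of_int p + of_int b = real q * of_int d + real (\<sigma> i)"
      by simp
    then have "real i * of_int p + real q * \<theta>
        = real q * of_int d + (real (\<sigma> i) + frac (real q * \<theta>))"
      by (simp add: frac_def b_def)
    then have "real i * of_int p / real q + \<theta>
        = (real (\<sigma> i) + frac (real q * \<theta>)) / real q + of_int d"
      using q by (simp add: field_simps)
    then show ?thesis using per by simp
  qed
  show ?thesis
    unfolding shift
    using sum.reindex_bij_betw[OF bij, of "\<lambda>j. f ((real j + frac (real q * \<theta>)) / real q)"] .
qed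

lemma sum_blocks:
  fixes g :: "nat \<Rightarrow> 'a::comm_monoid_add"
  shows "sum g {1..m * q} = (\<Sum>k<m. \<Sum>i<q. g (k * q + i + 1))"
proof -
  have "sum g {1..m * q} = (\<Sum>i<m * q. g (Suc i))"
    by (simp add: sum.atLeast_Suc_atMost_Suc_shift lessThan_atLeast0
        sum.atLeast1_atMost_eq)
  also have "\<dots> = (\<Sum>k<m. \<Sum>i\<in>{k * q..<k * q + q}. g (Suc i))"
    by (rule sum.nat_group [symmetric])
  also have "\<dots> = (\<Sum>k<m. \<Sum>i<q. g (k * q + i + 1))"
  proof (rule sum.cong [OF refl])
    fix k
    show "(\<Sum>i\<in>{k * q..<k * q + q}. g (Suc i)) = (\<Sum>i<q. g (k * q + i + 1))"
      using sum.shift_bounds_nat_ivl[of "\<lambda>i. g (Suc i)" 0 "k * q" q]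
      by (simp add: lessThan_atLeast0 add.commute)
  qed
  finally show ?thesis .
qed

section \<open>Lower bounds\<close>

lemma recip_sum_ge_twice:
  assumes "\<And>n. n \<ge> 1 \<Longrightarrow> 0 < int_dist (real n * \<alpha> - \<gamma>)"
  shows "2 * real N \<le> recip_sum N \<alpha> \<gamma>"
proof -
  have "2 \<le> 1 / int_dist (real n * \<alpha> - \<gamma>)" if "n \<in> {1..N}" for n
    using assms[of n] int_dist_le_half[of "real n * \<alpha> - \<gamma>"] that by (simp add: field_simps)
  then have "(\<Sum>n=1..N. 2) \<le> recip_sum N \<alpha> \<gamma>"
    unfolding recip_sum_def by (intro sum_mono)
  then show ?thesis by simp
qed

text \<open>
  After reordering, the \<open>j\<close>-th point is at distance at most \<open>(j+1)/q\<close> from 0, so the sum is at least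
  \<open>q\<close> times a harmonic sum. The extra \<open>1/q\<close> in the denominators leaves room for replacing
  \<open>\<alpha>\<close> by \<open>p/q\<close> within a block.
\<close>
lemma sum_recip_int_dist_ge:
  fixes \<theta> :: real
  assumes cop: "coprime p (int q)" and q: "0 < q"
  shows "real q * (ln (real q) - 1) \<le>
    (\<Sum>i<q. 1 / (int_dist (real i * of_int p / real q + \<theta>) + 1 / real q))"
proof -
  define t where "t = frac (real q * \<theta>)"
  have t: "0 \<le> t" "t < 1" by (simp_all add: t_def frac_lt_1)
  have summand: "real q * inverse (real (Suc (Suc j)))
      \<le> 1 / (int_dist ((real j + t) / real q) + 1 / real q)" for j
  proof -
    have "int_dist ((real j + t) / real q) \<le> (real j + t) / real q"
      using int_dist_le_abs[of "(real j + t) / real q"] t by simp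
    also have "\<dots> \<le> (real j + 1) / real q"
      using t q by (intro divide_right_mono) auto
    finally have "int_dist ((real j + t) / real q) + 1 / real q \<le> (real j + 2) / real q"
      by (simp add: add_divide_distrib)
    then have "1 / ((real j + 2) / real q) \<le> 1 / (int_dist ((real j + t) / real q) + 1 / real q)"
      using q by (intro divide_left_mono mult_pos_pos add_nonneg_pos divide_pos_pos) auto
    then show ?thesis by (simp add: field_simps)
  qed
  have "ln (real q) \<le> ln (real (Suc q) + 1)"
    using q by simp
  also have "\<dots> \<le> harm (Suc q)" by (rule ln_le_harm)
  also have "\<dots> = 1 + (\<Sum>j<q. inverse (real (Suc (Suc j))))"
    by (subst harm_altdef, subst sum.lessThan_Suc_shift) simp
  finally have "real q * (ln (real q) - 1) \<le> real q * (\<Sum>j<q. inverse (real (Suc (Suc j))))"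
    by (intro mult_left_mono) auto
  also have "\<dots> \<le> (\<Sum>j<q. 1 / (int_dist ((real j + t) / real q) + 1 / real q))"
    unfolding sum_distrib_left by (intro sum_mono summand)
  also have "\<dots> = (\<Sum>i<q. 1 / (int_dist (real i * of_int p / real q + \<theta>) + 1 / real q))"
    unfolding t_def using cop q
    by (intro sum_residues_periodic[symmetric, where f = "\<lambda>x. 1 / (int_dist x + 1 / real q)"]) auto
  finally show ?thesis .
qed

text \<open>
  The complete blocks of length \<open>q\<close> cover at least half of \<open>{1..N}\<close>. Measured from the first index of
  its block, each \<open>n\<close> is less than \<open>q\<close>, so \<open>\<alpha>\<close> can be replaced by \<open>p/q\<close> at the cost of an error of
  at most \<open>1/N \<le> 1/q\<close>.
\<close>
lemma recip_sum_ge_ln_denominator: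
  assumes pos: "\<And>n. n \<ge> 1 \<Longrightarrow> 0 < int_dist (real n * \<alpha> - \<gamma>)"
    and cop: "coprime p (int q)" and q: "0 < q" "q \<le> N"
    and approx: "\<bar>real q * \<alpha> - of_int p\<bar> \<le> 1 / real N"
  shows "real N / 2 * (ln (real q) - 1) \<le> recip_sum N \<alpha> \<gamma>"
proof (cases "ln (real q) \<ge> 1")
  case False
  then have "real N / 2 * (ln (real q) - 1) \<le> 0"
    by (intro mult_nonneg_nonpos) auto
  also have "\<dots> \<le> recip_sum N \<alpha> \<gamma>"
    using recip_sum_ge_twice[OF pos, of N] by linarith
  finally show ?thesis .
next
  case True
  define m where "m = N div q"
  define a where "a n = 1 / int_dist (real n * \<alpha> - \<gamma>)" for n
  have N: "0 < N" using q by simp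
  have "0 < m" using q by (simp add: m_def div_greater_zero_iff)
  have "N < m * q + q"
    unfolding m_def using q(1) by (metis dividend_less_times_div mult.commute add.commute)
  also have "\<dots> \<le> 2 * (m * q)" using \<open>0 < m\<close> by simp
  finally have "real N \<le> real (2 * (m * q))" by (intro of_nat_mono less_imp_le)
  then have half: "real N / 2 \<le> real (m * q)" by simp
  have block: "real q * (ln (real q) - 1) \<le> (\<Sum>i<q. a (k * q + i + 1))" for k
  proof -
    define \<theta> where "\<theta> = real (k * q + 1) * \<alpha> - \<gamma>"
    have "real q * (ln (real q) - 1) \<le>
        (\<Sum>i<q. 1 / (int_dist (real i * of_int p / real q + \<theta>) + 1 / real q))"
      using cop q(1) by (rule sum_recip_int_dist_ge)
    also have "\<dots> \<le> (\<Sum>i<q. a (k * q + i + 1))"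
    proof (rule sum_mono)
      fix i assume "i \<in> {..<q}"
      then have i: "i < q" by simp
      define x where "x = real (k * q + i + 1) * \<alpha> - \<gamma>"
      have "x - (real i * of_int p / real q + \<theta>) = real i / real q * (real q * \<alpha> - of_int p)"
        using q by (simp add: x_def \<theta>_def field_simps)
      then have "\<bar>x - (real i * of_int p / real q + \<theta>)\<bar>
          = real i / real q * \<bar>real q * \<alpha> - of_int p\<bar>"
        by (simp add: abs_mult)
      also have "\<dots> \<le> 1 * (1 / real N)"
        using i approx by (intro mult_mono) auto
      also have "\<dots> \<le> 1 / real q"
        using q by (simp add: field_simps)
      finally have "int_dist x \<le> int_dist (real i * of_int p / real q + \<theta>) + 1 / real q"
        using int_dist_lipschitz[of x "real i * of_int p / real q + \<theta>"] by linarith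
      moreover have "0 < int_dist x"
        unfolding x_def by (rule pos) simp
      ultimately show "1 / (int_dist (real i * of_int p / real q + \<theta>) + 1 / real q)
          \<le> a (k * q + i + 1)"
        unfolding a_def x_def [symmetric] by (intro divide_left_mono mult_pos_pos) auto
    qed
    finally show ?thesis .
  qed
  have "real N / 2 * (ln (real q) - 1) \<le> real (m * q) * (ln (real q) - 1)"
    using half True by (intro mult_right_mono) auto
  also have "\<dots> = (\<Sum>k<m. real q * (ln (real q) - 1))" by simp
  also have "\<dots> \<le> (\<Sum>k<m. \<Sum>i<q. a (k * q + i + 1))"
    by (intro sum_mono block)
  also have "\<dots> = sum a {1..m * q}" by (rule sum_blocks [symmetric])
  also have "\<dots> \<le> sum a {1..N}"
    by (intro sum_mono2) (auto simp: a_def m_def intro: order_trans)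
  finally show ?thesis by (simp add: recip_sum_def a_def)
qed

text \<open>
  The lower limit controls large \<open>n\<close> only; finitely many positive values remain, and their minimum
  is taken into account by shrinking the constant.
\<close>
lemma not_Liouville_lower_bound:
  assumes irr: "\<alpha> \<notin> \<rat>" and nL: "\<alpha> \<notin> Liouville"
  obtains w \<delta> :: real where "0 < w" "0 < \<delta>"
    "\<And>n. n \<ge> 1 \<Longrightarrow> \<delta> \<le> real n powr w * int_dist (real n * \<alpha>)"
proof -
  obtain w :: real where w: "0 < w"
    and ne: "liminf (\<lambda>n. ereal (real n powr w * int_dist (real n * \<alpha>))) \<noteq> 0"
    using irr nL by (auto simp: Liouville_def)
  define F where "F n = real n powr w * int_dist (real n * \<alpha>)" for n
  have "0 \<le> liminf (\<lambda>n. ereal (F n))"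
    by (intro Liminf_bounded always_eventually allI) (simp add: F_def)
  with ne have "0 < liminf (\<lambda>n. ereal (F n))"
    by (simp add: F_def order_less_le)
  then obtain e where e: "0 < ereal e" "ereal e < liminf (\<lambda>n. ereal (F n))"
    using ereal_dense2 by blast
  have "eventually (\<lambda>n. e < F n) sequentially"
    using less_LiminfD[OF e(2)] by simp
  then obtain n0 where n0: "\<And>n. n \<ge> n0 \<Longrightarrow> e < F n"
    by (auto simp: eventually_sequentially)
  define \<delta> where "\<delta> = Min (insert e (F ` {1..<n0}))"
  have pos: "0 < F n" if "n \<ge> 1" for n
    using int_dist_irrational_pos[OF irr, of n] that by (simp add: F_def)
  have "0 < \<delta>"
    unfolding \<delta>_def using e(1) pos by (subst Min_gr_iff) auto
  moreover have "\<delta> \<le> F n" if "n \<ge> 1" for n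
  proof (cases "n < n0")
    case True
    then show ?thesis unfolding \<delta>_def using that by (intro Min_le) auto
  next
    case False
    have "\<delta> \<le> e" unfolding \<delta>_def by (intro Min_le) auto
    then show ?thesis using n0[of n] False by simp
  qed
  ultimately show ?thesis using that[of w \<delta>] w by (simp add: F_def)
qed

text \<open>
  The lower bound through \<open>ln q\<close> loses an additive constant and is void for small \<open>N\<close>, where the
  trivial bound \<open>2 N\<close> takes over. A convex combination of the two bounds, with the weight \<open>s\<close> chosen
  so that the constants cancel, covers all \<open>N\<close> at once.
\<close>
lemma recip_sum_ge_of_not_Liouville:
  assumes irr: "\<alpha> \<notin> \<rat>" and nL: "\<alpha> \<notin> Liouville"
    and pos: "\<And>n. n \<ge> 1 \<Longrightarrow> 0 < int_dist (real n * \<alpha> - \<gamma>)"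
  shows "\<exists>c>0. \<forall>N\<ge>2. c * real N * ln (real N) \<le> recip_sum N \<alpha> \<gamma>"
proof -
  obtain w \<delta> :: real where w: "0 < w" and \<delta>: "0 < \<delta>"
    and lower: "\<And>n. n \<ge> 1 \<Longrightarrow> \<delta> \<le> real n powr w * int_dist (real n * \<alpha>)"
    using not_Liouville_lower_bound[OF irr nL] by metis
  define K where "K = (1 + \<bar>ln \<delta>\<bar> / w) / 2"
  have K: "0 < K" using w by (simp add: K_def add_pos_nonneg)
  define s where "s = 2 / (2 + K)"
  have s: "0 < s" "s < 1" "2 * (1 - s) = s * K"
    using K by (auto simp: s_def field_simps)
  have "s / (2 * w) * real N * ln (real N) \<le> recip_sum N \<alpha> \<gamma>" if N: "N \<ge> 2" for N
  proof -
    obtain p k where pk: "coprime p k" "0 < k" "k \<le> int N" "\<bar>of_int k * \<alpha> - of_int p\<bar> < 1 / real N"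
      using Dirichlet_approx_coprime[of N \<alpha>] N by auto
    define q where "q = nat k"
    have q: "coprime p (int q)" "0 < q" "q \<le> N" "\<bar>real q * \<alpha> - of_int p\<bar> < 1 / real N"
      using pk by (auto simp: q_def)
    have "\<delta> \<le> real q powr w * int_dist (real q * \<alpha>)"
      using lower[of q] q(2) by simp
    also have "\<dots> \<le> real q powr w * (1 / real N)"
      using int_dist_le[of "real q * \<alpha>" p] q(4) by (intro mult_left_mono) auto
    finally have "\<delta> * real N \<le> real q powr w"
      using N by (simp add: field_simps)
    then have "ln (\<delta> * real N) \<le> ln (real q powr w)"
      using \<delta> N q(2) by (subst ln_le_cancel_iff) auto
    then have "ln \<delta> + ln (real N) \<le> w * ln (real q)"
      using \<delta> N q(2) by (simp add: ln_mult ln_powr)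
    then have "ln (real N) - \<bar>ln \<delta>\<bar> \<le> w * ln (real q)" by linarith
    then have "(ln (real N) - \<bar>ln \<delta>\<bar>) / w \<le> ln (real q)"
      using w by (simp add: divide_le_eq mult.commute)
    then have "ln (real N) / (2 * w) - K \<le> (ln (real q) - 1) / 2"
      using w by (simp add: K_def field_simps)
    then have "real N * (ln (real N) / (2 * w) - K) \<le> real N * ((ln (real q) - 1) / 2)"
      by (intro mult_left_mono) auto
    also have "\<dots> \<le> recip_sum N \<alpha> \<gamma>"
      using recip_sum_ge_ln_denominator[OF pos q(1-3)] q(4) by simp
    finally have large: "real N * (ln (real N) / (2 * w) - K) \<le> recip_sum N \<alpha> \<gamma>" .
    have "s / (2 * w) * real N * ln (real N)
        = real N * (2 * (1 - s) + s * (ln (real N) / (2 * w) - K))"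
      unfolding s(3) by (simp add: algebra_simps)
    also have "\<dots> = (1 - s) * (2 * real N) + s * (real N * (ln (real N) / (2 * w) - K))"
      by (simp add: algebra_simps)
    also have "\<dots> \<le> (1 - s) * recip_sum N \<alpha> \<gamma> + s * recip_sum N \<alpha> \<gamma>"
      using s large recip_sum_ge_twice[OF pos, of N] by (intro add_mono mult_left_mono) auto
    also have "\<dots> = recip_sum N \<alpha> \<gamma>" by (simp add: algebra_simps)
    finally show ?thesis .
  qed
  moreover have "0 < s / (2 * w)" using s w by simp
  ultimately show ?thesis by blast
qed

section \<open>Upper bounds\<close>

lemma harm_le_1_plus_ln:
  assumes "0 < n"
  shows "harm n \<le> 1 + ln (real n)"
  using decseqD[OF decseq_harm_diff_ln, of 0 "n - 1"] assms by (simp add: harm_expand)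

text \<open>
  The hypothesis on \<open>q \<theta>\<close> keeps its fractional part \<open>t\<close> between 1/4 and 3/4. The points \<open>(j + t)/q\<close>
  then stay away from both 0 and 1 by at least a quarter step, and each of the two sums arising from
  the distances to 0 and to 1 is at most \<open>4 q\<close> times a harmonic sum.
\<close>
lemma sum_recip_int_dist_le:
  fixes \<theta> :: real
  assumes cop: "coprime p (int q)" and q: "0 < q"
    and far: "1 / 4 \<le> int_dist (real q * \<theta>)"
  shows "(\<Sum>i<q. 1 / int_dist (real i * of_int p / real q + \<theta>))
    \<le> 8 * real q * (1 + ln (real q))"
proof -
  define t where "t = frac (real q * \<theta>)"
  have "1 / 4 \<le> int_dist t" using far by (simp add: t_def)
  then have t: "1 / 4 \<le> t" "t \<le> 3 / 4"
    using int_dist_le[of t 0] int_dist_le[of t 1] frac_lt_1[of "real q * \<theta>"]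
      frac_ge_0[of "real q * \<theta>"] unfolding t_def by auto
  define h where "h j = 4 * real q * inverse (real (Suc j))" for j
  have summand: "1 / int_dist ((real j + t) / real q) \<le> h j + h (q - Suc j)" if "j < q" for j
  proof -
    have j: "real j + 1 \<le> real q" using that by linarith
    have "1 / int_dist ((real j + t) / real q)
        \<le> 1 / ((real j + t) / real q) + 1 / (1 - (real j + t) / real q)"
      using j t q by (intro inverse_int_dist_le) auto
    moreover have "1 / ((real j + t) / real q) \<le> h j"
    proof -
      have "real (Suc j) \<le> 4 * (real j + t)" using t by simp
      then have "real q * (1 / (real j + t)) \<le> real q * (4 / real (Suc j))"
        using t by (intro mult_left_mono) (auto simp: divide_simps)
      then show ?thesis by (simp add: h_def divide_inverse mult_ac)
    qed
    moreover have "1 / (1 - (real j + t) / real q) \<le> h (q - Suc j)"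
    proof -
      have "real (Suc (q - Suc j)) = real q - real j" using that by simp
      then have "real (Suc (q - Suc j)) \<le> 4 * (real q - real j - t)" "0 < real q - real j - t"
        using t j by (simp_all add: algebra_simps)
      then have "real q * (1 / (real q - real j - t)) \<le> real q * (4 / real (Suc (q - Suc j)))"
        by (intro mult_left_mono) (auto simp: divide_simps)
      moreover have "1 / (1 - (real j + t) / real q) = real q * (1 / (real q - real j - t))"
        using q by (simp add: field_simps)
      ultimately show ?thesis by (simp add: h_def divide_inverse mult.assoc mult.left_commute)
    qed
    ultimately show ?thesis by linarith
  qed
  have "(\<Sum>i<q. 1 / int_dist (real i * of_int p / real q + \<theta>))
      = (\<Sum>j<q. 1 / int_dist ((real j + t) / real q))"
    unfolding t_def using cop q
    by (intro sum_residues_periodic[where f = "\<lambda>x. 1 / int_dist x"]) auto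
  also have "\<dots> \<le> (\<Sum>j<q. h j + h (q - Suc j))"
    using summand by (intro sum_mono) auto
  also have "\<dots> = 2 * (\<Sum>j<q. h j)"
    by (simp add: sum.distrib sum.nat_diff_reindex)
  also have "\<dots> = 8 * real q * harm q"
    by (simp add: h_def harm_altdef sum_distrib_left mult.assoc)
  also have "\<dots> \<le> 8 * real q * (1 + ln (real q))"
    using harm_le_1_plus_ln[OF q] by (intro mult_left_mono) auto
  finally show ?thesis .
qed

text \<open>
  All \<open>n p/q - \<gamma>\<close> have distance at least \<open>1/(4q)\<close> from the integers, whereas replacing \<open>p/q\<close> by \<open>\<alpha>\<close>
  moves them by at most \<open>1/(8q)\<close> in the whole range. Hence the replacement changes each term by a
  factor of at most 2.
\<close>
lemma recip_sum_le_ln_denominator: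
  assumes cop: "coprime p (int q)" and q: "0 < q"
    and approx: "\<bar>real q * \<alpha> - of_int p\<bar> * (8 * real (m * q)) \<le> 1"
    and far: "1 / 4 \<le> int_dist (real q * \<gamma>)"
  shows "recip_sum (m * q) \<alpha> \<gamma> \<le> 16 * real (m * q) * (1 + ln (real q))"
proof -
  define b where "b n = 1 / int_dist (real n * of_int p / real q - \<gamma>)" for n
  have "recip_sum (m * q) \<alpha> \<gamma> \<le> (\<Sum>n=1..m * q. 2 * b n)"
    unfolding recip_sum_def
  proof (rule sum_mono)
    fix n assume "n \<in> {1..m * q}"
    then have n: "n \<le> m * q" by simp
    define y where "y = real n * of_int p / real q - \<gamma>"
    have "real q * \<gamma> = of_int (int n * p) + - (of_int (int q) * y)"
      using q by (simp add: y_def field_simps)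
    then have "int_dist (real q * \<gamma>) = int_dist (of_int (int q) * y)"
      by (metis add.commute int_dist_add_int int_dist_minus)
    also have "\<dots> \<le> real q * int_dist y"
      using int_dist_mult_le[of "int q" y] by simp
    finally have y: "1 / (4 * real q) \<le> int_dist y"
      using far q by (simp add: field_simps)
    have "y - (real n * \<alpha> - \<gamma>) = - (real n / real q) * (real q * \<alpha> - of_int p)"
      using q by (simp add: y_def field_simps)
    then have "\<bar>y - (real n * \<alpha> - \<gamma>)\<bar> = real n / real q * \<bar>real q * \<alpha> - of_int p\<bar>"
      by (simp add: abs_mult)
    also have "\<dots> \<le> real (m * q) / real q * \<bar>real q * \<alpha> - of_int p\<bar>"
      using n by (intro mult_right_mono divide_right_mono) (auto simp del: of_nat_mult)
    also have "\<dots> \<le> 1 / (8 * real q)"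
      using approx q by (simp add: field_simps)
    finally have "\<bar>y - (real n * \<alpha> - \<gamma>)\<bar> \<le> int_dist y / 2"
      using y by simp
    then have "int_dist y / 2 \<le> int_dist (real n * \<alpha> - \<gamma>)"
      using int_dist_lipschitz[of y "real n * \<alpha> - \<gamma>"] by linarith
    moreover have "0 < int_dist y"
      using y q by (meson divide_pos_pos less_le_trans mult_pos_pos of_nat_0_less_iff zero_less_numeral zero_less_one)
    ultimately have "1 / int_dist (real n * \<alpha> - \<gamma>) \<le> 1 / (int_dist y / 2)"
      by (intro divide_left_mono mult_pos_pos) auto
    then show "1 / int_dist (real n * \<alpha> - \<gamma>) \<le> 2 * b n"
      by (simp add: b_def y_def)
  qed
  also have "\<dots> = 2 * (\<Sum>k<m. \<Sum>i<q. b (k * q + i + 1))"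
    by (simp only: sum_distrib_left [symmetric] sum_blocks)
  also have "\<dots> \<le> 2 * (\<Sum>k<m. 8 * real q * (1 + ln (real q)))"
  proof (intro mult_left_mono sum_mono)
    fix k
    define \<theta> where "\<theta> = real (k * q + 1) * of_int p / real q - \<gamma>"
    have "real q * \<theta> = - (real q * \<gamma>) + of_int (int (k * q + 1) * p)"
      using q by (simp add: \<theta>_def field_simps)
    then have "1 / 4 \<le> int_dist (real q * \<theta>)"
      using far by (simp only: int_dist_add_int int_dist_minus)
    then have "(\<Sum>i<q. 1 / int_dist (real i * of_int p / real q + \<theta>)) \<le> 8 * real q * (1 + ln (real q))"
      by (rule sum_recip_int_dist_le[OF cop q])
    then show "(\<Sum>i<q. b (k * q + i + 1)) \<le> 8 * real q * (1 + ln (real q))"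
      by (simp add: b_def \<theta>_def add_divide_distrib algebra_simps)
  qed simp
  also have "\<dots> = 16 * real (m * q) * (1 + ln (real q))" by simp
  finally show ?thesis .
qed

section \<open>Liouville numbers\<close>

text \<open>
  The parameter \<open>W\<close> is both the quality of the approximation and a lower bound for the denominator,
  so that a single index describes the passage to ever better approximations.
\<close>
definition Liouville_approx :: "real \<Rightarrow> nat \<Rightarrow> int \<Rightarrow> nat \<Rightarrow> bool" where
  "Liouville_approx \<alpha> W p q \<longleftrightarrow>
     coprime p (int q) \<and> 0 < q \<and> W \<le> q \<and> \<bar>real q * \<alpha> - of_int p\<bar> * real q ^ W \<le> 1"

text \<open>
  The lower limit being 0 provides some \<open>n\<close> with \<open>\<parallel>n\<alpha>\<parallel>\<close> extremely small. Cancelling the common factor of \<open>n\<close>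
  and the nearest integer to \<open>n\<alpha>\<close> only improves the approximation, but it might make the denominator
  small. This is excluded by asking that \<open>\<parallel>n\<alpha>\<parallel>\<close> be below the minimum \<open>\<mu>\<close> of \<open>\<parallel>k\<alpha>\<parallel>\<close> over the small
  denominators \<open>k\<close>, which is positive by irrationality.
\<close>
lemma Liouville_approx_exists:
  assumes L: "\<alpha> \<in> Liouville"
  shows "\<exists>p q. Q \<le> q \<and> Liouville_approx \<alpha> W p q"
proof -
  define V where "V = Suc (max W Q)"
  have irr: "\<alpha> \<notin> \<rat>" using L by (simp add: Liouville_def)
  define \<mu> where "\<mu> = Min (insert 1 ((\<lambda>n. int_dist (real n * \<alpha>)) ` {1..V}))"
  have \<mu>: "0 < \<mu>" "\<mu> \<le> 1"
    unfolding \<mu>_def using int_dist_irrational_pos[OF irr] by (subst Min_gr_iff, auto)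
  have \<mu>_le: "\<mu> \<le> int_dist (real n * \<alpha>)" if "1 \<le> n" "n \<le> V" for n
    unfolding \<mu>_def using that by (intro Min_le) auto
  have "liminf (\<lambda>n. ereal (real n powr real V * int_dist (real n * \<alpha>))) = 0"
    using L by (auto simp: Liouville_def V_def)
  then have "\<not> ereal \<mu> \<le> liminf (\<lambda>n. ereal (real n powr real V * int_dist (real n * \<alpha>)))"
    using \<mu> by simp
  then have "\<not> (\<forall>\<^sub>F n in sequentially.
      ereal \<mu> \<le> ereal (real n powr real V * int_dist (real n * \<alpha>)))"
    by (rule contrapos_nn) (rule Liminf_bounded)
  then have "\<not> (\<forall>n\<ge>1. \<mu> \<le> real n powr real V * int_dist (real n * \<alpha>))"
    unfolding eventually_sequentially ereal_less_eq by blast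
  then obtain n where n: "1 \<le> n" "real n powr real V * int_dist (real n * \<alpha>) < \<mu>"
    by (auto simp: not_le)
  have nV: "real n ^ V * int_dist (real n * \<alpha>) < \<mu>"
    using n by (simp add: powr_realpow)
  define r where "r = round (real n * \<alpha>)"
  define d where "d = gcd r (int n)"
  define p where "p = r div d"
  define q where "q = nat (int n div d)"
  have d: "0 < d" using n by (simp add: d_def)
  have r_eq: "r = d * p" by (simp add: p_def d_def)
  have q_int: "int q = int n div d"
    using d by (simp add: q_def pos_imp_zdiv_nonneg_iff)
  have n_eq: "int n = d * int q"
    by (simp add: q_int d_def)
  have q: "0 < q" using n n_eq by (cases "q = 0") auto
  have cop: "coprime p (int q)"
    unfolding p_def q_int d_def using n by (intro div_gcd_coprime) auto
  have qn: "q \<le> n"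
  proof -
    have "1 * int q \<le> d * int q" using d by (intro mult_right_mono) auto
    then show ?thesis using n_eq by simp
  qed
  define e where "e = \<bar>real q * \<alpha> - of_int p\<bar>"
  have "int_dist (real n * \<alpha>) = \<bar>of_int d * (real q * \<alpha> - of_int p)\<bar>"
  proof -
    have "real n = of_int d * real q"
      using n_eq by (metis of_int_mult of_int_of_nat_eq)
    moreover have "int_dist (real n * \<alpha>) = \<bar>real n * \<alpha> - of_int (d * p)\<bar>"
      unfolding int_dist_def r_def [symmetric] r_eq [symmetric] ..
    ultimately show ?thesis by (simp add: algebra_simps)
  qed
  also have "\<dots> = of_int d * e" using d by (simp add: abs_mult e_def)
  finally have "int_dist (real n * \<alpha>) = of_int d * e" .
  moreover have "1 * e \<le> of_int d * e" using d by (intro mult_right_mono) (auto simp: e_def)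
  ultimately have e_le: "e \<le> int_dist (real n * \<alpha>)" by simp
  have "e * real q ^ V \<le> int_dist (real n * \<alpha>) * real n ^ V"
    using e_le qn by (intro mult_mono power_mono) auto
  then have e_small: "e * real q ^ V < \<mu>" using nV by (simp add: mult.commute)
  have "e * 1 \<le> e * real q ^ V"
    using q by (intro mult_left_mono) (auto simp: e_def)
  then have "e < \<mu>" using e_small by simp
  moreover have "int_dist (real q * \<alpha>) \<le> e" unfolding e_def by (rule int_dist_le)
  ultimately have "V < q" using \<mu>_le[of q] q by force
  moreover have "e * real q ^ W \<le> 1"
  proof -
    have "e * real q ^ W \<le> e * real q ^ V"
      using q by (intro mult_left_mono power_increasing) (auto simp: e_def V_def)
    then show ?thesis using e_small \<mu> by simp
  qed
  ultimately show ?thesis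
    using cop q by (intro exI[of _ p] exI[of _ q]) (auto simp: Liouville_approx_def V_def e_def)
qed

text \<open>
  For each \<open>W\<close> the admissible \<open>\<gamma>\<close> form an open set. It is dense, because the points \<open>(k + 1/2)/q\<close>, at
  which \<open>\<parallel>q\<gamma>\<parallel> = 1/2\<close>, meet any given interval once \<open>q\<close> is large. By Baire's theorem the intersection
  over all \<open>W\<close> is nonempty.
\<close>
lemma Liouville_generic_shift:
  assumes L: "\<alpha> \<in> Liouville"
  obtains \<gamma> where "\<And>W. \<exists>p q. Liouville_approx \<alpha> W p q \<and> 1 / 4 < int_dist (real q * \<gamma>)"
proof -
  define U where
    "U W = {\<gamma>. \<exists>p q. Liouville_approx \<alpha> W p q \<and> 1 / 4 < int_dist (real q * \<gamma>)}" for W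
  have "open (U W)" for W
  proof -
    have "U W = (\<Union>(p, q) \<in> {(p, q). Liouville_approx \<alpha> W p q}. {\<gamma>. 1 / 4 < int_dist (real q * \<gamma>)})"
      by (auto simp: U_def)
    moreover have "open {\<gamma>. 1 / 4 < int_dist (real q * \<gamma>)}" for q
      by (intro open_Collect_less continuous_intros
          continuous_on_compose2[OF continuous_on_int_dist[of UNIV]]) auto
    ultimately show ?thesis by auto
  qed
  moreover have "closure (U W) = UNIV" for W
  proof -
    have "\<exists>y\<in>U W. dist y x < e" if "0 < e" for x e
    proof -
      obtain Q :: nat where Q: "1 / e < real Q" using reals_Archimedean2 by blast
      obtain p q where q: "Q \<le> q" "Liouville_approx \<alpha> W p q"
        using Liouville_approx_exists[OF L] by blast
      have q0: "0 < q" using q by (simp add: Liouville_approx_def)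
      define y where "y = (of_int \<lfloor>real q * x\<rfloor> + 1 / 2) / real q"
      have "real q * y = of_int \<lfloor>real q * x\<rfloor> + 1 / 2" using q0 by (simp add: y_def)
      then have yU: "y \<in> U W" and near: "\<bar>real q * y - real q * x\<bar> < 1"
        using q(2) by (auto simp: U_def intro!: exI[of _ p] exI[of _ q]) linarith
      have "real q * dist y x < 1"
        using near q0 by (simp add: dist_real_def abs_mult right_diff_distrib [symmetric])
      also have "1 < real q * e"
      proof -
        have "1 / e < real q" using Q q(1) by linarith
        then show ?thesis using that by (simp add: field_simps)
      qed
      finally have "dist y x < e" using q0 by simp
      then show ?thesis using yU by blast
    qed
    then show ?thesis by (auto simp: closure_approachable)
  qed
  ultimately have "UNIV \<subseteq> closure (\<Inter>(range U))"
    by (intro Baire) auto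
  then have "\<Inter>(range U) \<noteq> {}" by auto
  then obtain \<gamma> where "\<gamma> \<in> \<Inter>(range U)" by blast
  then show ?thesis by (intro that[of \<gamma>]) (auto simp: U_def)
qed

text \<open>
  If \<open>\<gamma>\<close> were \<open>n\<alpha> - k\<close>, then \<open>\<parallel>q\<gamma>\<parallel> \<le> n \<parallel>q\<alpha>\<parallel> \<le> n/q\<close>, which is below \<open>1/4\<close> once \<open>q > 4 n\<close>.
\<close>
lemma generic_shift_not_multiple:
  assumes gen: "\<And>W. \<exists>p q. Liouville_approx \<alpha> W p q \<and> 1 / 4 < int_dist (real q * \<gamma>)"
  shows "0 < int_dist (real n * \<alpha> - \<gamma>)"
proof (rule ccontr)
  assume "\<not> ?thesis"
  then have "int_dist (real n * \<alpha> - \<gamma>) = 0"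
    using int_dist_nonneg[of "real n * \<alpha> - \<gamma>"] by linarith
  then obtain k :: int where k: "\<gamma> = real n * \<alpha> - of_int k"
    using that[of "round (real n * \<alpha> - \<gamma>)"] by (simp add: int_dist_def)
  obtain p q where pq: "Liouville_approx \<alpha> (4 * n + 1) p q" "1 / 4 < int_dist (real q * \<gamma>)"
    using gen by blast
  have q: "0 < q" "4 * n + 1 \<le> q" 
    and small: "\<bar>real q * \<alpha> - of_int p\<bar> * real q ^ (4 * n + 1) \<le> 1"
    using pq(1) by (auto simp: Liouville_approx_def)
  have "\<bar>real q * \<alpha> - of_int p\<bar> * real q ^ 1 \<le> \<bar>real q * \<alpha> - of_int p\<bar> * real q ^ (4 * n + 1)"
    using q by (intro mult_left_mono power_increasing) auto
  then have e: "real q * \<bar>real q * \<alpha> - of_int p\<bar> \<le> 1"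
    using small by (simp add: mult.commute)
  have "real q * \<gamma> = of_int (int n) * (real q * \<alpha>) + of_int (- (int q * k))"
    by (simp add: k algebra_simps)
  then have "int_dist (real q * \<gamma>) = int_dist (of_int (int n) * (real q * \<alpha>))"
    by (metis int_dist_add_int)
  also have "\<dots> \<le> real n * int_dist (real q * \<alpha>)"
    using int_dist_mult_le[of "int n" "real q * \<alpha>"] by simp
  also have "\<dots> \<le> real n * \<bar>real q * \<alpha> - of_int p\<bar>"
    by (intro mult_left_mono int_dist_le) auto
  also have "\<dots> \<le> real q / 4 * \<bar>real q * \<alpha> - of_int p\<bar>"
    using q by (intro mult_right_mono) auto
  also have "\<dots> \<le> 1 / 4" using e by simp
  finally show False using pq(2) by simp
qed

lemma generic_shift_recip_sum_small:
  assumes gen: "\<And>W. \<exists>p q. Liouville_approx \<alpha> W p q \<and> 1 / 4 < int_dist (real q * \<gamma>)"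
    and c: "0 < c"
  shows "\<exists>N\<ge>2. recip_sum N \<alpha> \<gamma> < c * real N * ln (real N)"
proof -
  \<comment> \<open>The sum up to \<open>N = q^(v+1)\<close> is at most \<open>32 N ln q = 32 / (v+1) * N ln N\<close>. In \<open>v + 8\<close>, the summand
    8 ensures \<open>q \<ge> 8\<close>, whence \<open>8 N \<le> q^(v+2)\<close> and \<open>ln q \<ge> 1\<close>.\<close>
  obtain v :: nat where v: "32 / c < real v" using reals_Archimedean2 by blast
  obtain p q where pq: "Liouville_approx \<alpha> (v + 8) p q" "1 / 4 < int_dist (real q * \<gamma>)"
    using gen by blast
  have cop: "coprime p (int q)" and q: "8 \<le> q"
    and small: "\<bar>real q * \<alpha> - of_int p\<bar> * real q ^ (v + 8) \<le> 1"
    using pq(1) by (auto simp: Liouville_approx_def)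
  define N where "N = q ^ v * q"
  have "q \<le> N" using q by (simp add: N_def)
  then have N: "2 \<le> N" using q by simp
  have "8 * real N \<le> real q * real N" using q by (intro mult_right_mono) auto
  also have "\<dots> = real q ^ (v + 2)" by (simp add: N_def power_add power2_eq_square)
  also have "\<dots> \<le> real q ^ (v + 8)" using q by (intro power_increasing) auto
  finally have "\<bar>real q * \<alpha> - of_int p\<bar> * (8 * real N) \<le> \<bar>real q * \<alpha> - of_int p\<bar> * real q ^ (v + 8)"
    by (intro mult_left_mono) auto
  also have "\<dots> \<le> 1" by (rule small)
  finally have upper: "recip_sum N \<alpha> \<gamma> \<le> 16 * real N * (1 + ln (real q))"
    unfolding N_def using cop q pq(2) by (intro recip_sum_le_ln_denominator) auto
  have ln_q: "1 \<le> ln (real q)"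
    using q exp_le by (subst ln_ge_iff) auto
  note upper
  also have "16 * real N * (1 + ln (real q)) \<le> 16 * real N * (2 * ln (real q))"
    using ln_q by (intro mult_left_mono) auto
  also have "\<dots> = real N * (32 * ln (real q))" by simp
  also have "\<dots> < real N * (c * real (v + 1) * ln (real q))"
  proof -
    have "32 < c * real (v + 1)" using v c by (simp add: field_simps)
    then show ?thesis using N ln_q by (intro mult_strict_left_mono mult_strict_right_mono) auto
  qed
  also have "\<dots> = c * real N * ln (real N)"
  proof -
    have "real N = real q ^ (v + 1)" by (simp add: N_def)
    then have "ln (real N) = real (v + 1) * ln (real q)"
      using q by (simp add: ln_realpow del: power_Suc)
    then show ?thesis by simp
  qed
  finally show ?thesis using N by blast
qed

theorem theorem1p8:
  fixes \<alpha> :: real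
  assumes "\<alpha> \<notin> \<rat>"
  shows "\<alpha> \<notin> Liouville \<longleftrightarrow>
    (\<forall>\<gamma>::real. (\<forall>n::nat. n \<ge> 1 \<longrightarrow> int_dist (real n * \<alpha> - \<gamma>) > 0) \<longrightarrow>
       (\<exists>c::real. c > 0 \<and>
          (\<forall>N::nat. N \<ge> 2 \<longrightarrow> recip_sum N \<alpha> \<gamma> \<ge> c * real N * ln (real N))))"
    (is "_ \<longleftrightarrow> ?bound")
proof
  assume "\<alpha> \<notin> Liouville"
  then show ?bound
    using recip_sum_ge_of_not_Liouville[OF assms] by blast
next
  assume bound: ?bound
  show "\<alpha> \<notin> Liouville"
  proof
    assume "\<alpha> \<in> Liouville"
    then obtain \<gamma> where
      gen: "\<And>W. \<exists>p q. Liouville_approx \<alpha> W p q \<and> 1 / 4 < int_dist (real q * \<gamma>)"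
      using Liouville_generic_shift by blast
    obtain c where "0 < c" "\<And>N. N \<ge> 2 \<Longrightarrow> c * real N * ln (real N) \<le> recip_sum N \<alpha> \<gamma>"
      using bound generic_shift_not_multiple[OF gen] by blast
    then show False
      using generic_shift_recip_sum_small[OF gen, of c] by (meson not_le)
  qed
qed

end
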